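(* Suppose that $\mathcal{F}$ is a semigroup of entire functions such that the escaping like set $I(\mathcal{F})$ has at least two points and is invariant (both forward and backward). Then $J(\mathcal{F})=\partial I(\mathcal{F})$.
   Context: A semigroup of entire functions is a family of entire functions closed under composition. A family $\mathcal{F}$ of entire functions is normal on an open set if every sequence in $\mathcal{F}$ has a subsequence that converges locally uniformly on that open set either to a holomorphic function or to $\infty$; it is normal at a point if it is normal on some neighborhood of that point. The Fatou like set $F(\mathcal{F})\subseteq\mathbb{C}$ is the set of points at which $\mathcal{F}$ is normal, and the Julia like set is $J(\mathcal{F}):=\mathbb{C}\setminus F(\mathcal{F})$. An infinite sequence in $\mathcal{F}$ means a sequence $\{f_n\}\subset\mathcal{F}$ with $f_m\neq f_n$ for $m\neq n$. The escaping like set is $I(\mathcal{F}):=\{z\in\mathbb{C}: f_n(z)\to\infty \text{ for every infinite sequence } \{f_n\} \text{ in } \mathcal{F}\}$. A set $S\subseteq\mathbb{C}$ is forward invariant if $f(S)\subseteq S$ for every $f\in\mathcal{F}$, and backward invariant if $f^{-1}(S)\subseteq S$ for every $f\in\mathcal{F}$. $\partial$ denotes the boundary in $\mathbb{C}$. *)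

theory Defs
  imports "HOL-Complex_Analysis.Complex_Analysis"
begin

definition entire_semigroup :: "(complex \<Rightarrow> complex) set \<Rightarrow> bool" where
  "entire_semigroup \<F> \<longleftrightarrow>
     (\<forall>f\<in>\<F>. f holomorphic_on UNIV) \<and> (\<forall>f\<in>\<F>. \<forall>g\<in>\<F>. f \<circ> g \<in> \<F>)"

definition locally_uniform_limit ::
    "complex set \<Rightarrow> (nat \<Rightarrow> complex \<Rightarrow> complex) \<Rightarrow> (complex \<Rightarrow> complex) \<Rightarrow> bool" where
  "locally_uniform_limit U f g \<longleftrightarrow>
     (\<forall>z\<in>U. \<exists>V. open V \<and> z \<in> V \<and> V \<subseteq> U \<and> uniform_limit V f g sequentially)"

definition locally_uniform_limit_infinity ::
    "complex set \<Rightarrow> (nat \<Rightarrow> complex \<Rightarrow> complex) \<Rightarrow> bool" where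
  "locally_uniform_limit_infinity U f \<longleftrightarrow>
     (\<forall>z\<in>U. \<exists>V. open V \<and> z \<in> V \<and> V \<subseteq> U \<and>
        (\<forall>B::real. \<forall>\<^sub>F n in sequentially. \<forall>w\<in>V. B < norm (f n w)))"

text \<open>Sequences here may repeat members. The alternative between a holomorphic limit and
  \<open>\<infinity>\<close> is global on \<open>U\<close>, not per connected component; this makes no difference
  for normality at a point, where \<open>U\<close> can be shrunk to a disc.\<close>
definition normal_family_on :: "(complex \<Rightarrow> complex) set \<Rightarrow> complex set \<Rightarrow> bool" where
  "normal_family_on \<F> U \<longleftrightarrow>
     (\<forall>f :: nat \<Rightarrow> complex \<Rightarrow> complex. range f \<subseteq> \<F> \<longrightarrow>
        (\<exists>r :: nat \<Rightarrow> nat. strict_mono r \<and>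
           ((\<exists>g. g holomorphic_on U \<and> locally_uniform_limit U (f \<circ> r) g) \<or>
            locally_uniform_limit_infinity U (f \<circ> r))))"

definition fatou_like :: "(complex \<Rightarrow> complex) set \<Rightarrow> complex set" where
  "fatou_like \<F> = {z. \<exists>U. open U \<and> z \<in> U \<and> normal_family_on \<F> U}"

definition julia_like :: "(complex \<Rightarrow> complex) set \<Rightarrow> complex set" where
  "julia_like \<F> = - fatou_like \<F>"

text \<open>An infinite sequence in \<open>\<F>\<close> is one with pairwise distinct members. If \<open>\<F>\<close> is finite
  there is none, and the escaping like set is the whole plane.\<close>
definition infinite_sequence_in :: "(complex \<Rightarrow> complex) set \<Rightarrow> (nat \<Rightarrow> complex \<Rightarrow> complex) \<Rightarrow> bool" where
  "infinite_sequence_in \<F> f \<longleftrightarrow> inj f \<and> range f \<subseteq> \<F>"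

definition escaping_like :: "(complex \<Rightarrow> complex) set \<Rightarrow> complex set" where
  "escaping_like \<F> =
     {z. \<forall>f. infinite_sequence_in \<F> f \<longrightarrow> filterlim (\<lambda>n. f n z) at_infinity sequentially}"

definition forward_invariant :: "(complex \<Rightarrow> complex) set \<Rightarrow> complex set \<Rightarrow> bool" where
  "forward_invariant \<F> S \<longleftrightarrow> (\<forall>f\<in>\<F>. f ` S \<subseteq> S)"

definition backward_invariant :: "(complex \<Rightarrow> complex) set \<Rightarrow> complex set \<Rightarrow> bool" where
  "backward_invariant \<F> S \<longleftrightarrow> (\<forall>f\<in>\<F>. f -` S \<subseteq> S)"

end

theory Submission
  imports Defs
begin

text \<open>
  A normal limit near a frontier point of \<open>I\<close> would have to be infinite at nearby points of \<open>I\<close>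
  and finite at nearby points off \<open>I\<close>, so the frontier lies in \<open>J\<close>.

  Off the closure of \<open>I\<close>, backward invariance makes the family omit two points of \<open>I\<close>, and
  Montel's theorem gives normality. In the interior of \<open>I\<close>, forward invariance makes it omit the
  complement of \<open>I\<close>, which suffices unless that complement has at most one point. In that case
  there is no room for periodic points: a periodic point of \<open>f\<close> in \<open>I\<close> forces two iterates of \<open>f\<close>
  to coincide, so \<open>f\<close> is constant or affine with a multiplier of modulus 1. Picard-type theorems
  supply periodic points for every other \<open>f\<close>: if \<open>I\<close> is the plane, \<open>f \<circ> f\<close> has a fixed point unless
  \<open>f\<close> is a translation; if \<open>I\<close> omits only \<open>p\<close>, the quotient \<open>(f z - p) / (z - p)\<close> takes the value 1
  away from \<open>p\<close> unless it is constant. The remaining families are explicit enough that escape at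
  one point implies locally uniform escape nearby.
\<close>

section \<open>Normal families and omitted values\<close>

text \<open>Normality quantifies over sequences that may repeat members, escape only over injective
  ones; this dichotomy connects the two.\<close>

lemma subsequence_injective_or_constant:
  fixes f :: "nat \<Rightarrow> 'a"
  obtains (inject) r :: "nat \<Rightarrow> nat" where "strict_mono r" "inj (f \<circ> r)"
    | (const) r :: "nat \<Rightarrow> nat" and c where "strict_mono r" "\<And>n. f (r n) = c"
proof (cases "finite (range f)")
  case True
  then obtain m where inf: "infinite {n. f n = f m}"
    using pigeonhole_infinite[of UNIV f] by auto
  show ?thesis
  proof (rule const)
    show "strict_mono (enumerate {n. f n = f m})"
      by (rule strict_mono_enumerate[OF inf])
    show "f (enumerate {n. f n = f m} n) = f m" for n
      using enumerate_in_set[OF inf, of n] by simp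
  qed
next
  case False
  \<comment> \<open>Keeping only the index of the first occurrence of each value makes
    \<open>f\<close> injective on \<open>S\<close> without shrinking its range.\<close>
  define S where "S = {n. \<forall>m<n. f m \<noteq> f n}"
  have "range f \<subseteq> f ` S"
  proof safe
    fix n
    define k where "k = (LEAST k. f k = f n)"
    have "f k = f n" unfolding k_def by (rule LeastI) simp
    moreover have "k \<in> S"
      unfolding S_def using not_less_Least[of _ "\<lambda>k. f k = f n"] \<open>f k = f n\<close>
      by (auto simp: k_def[symmetric])
    ultimately show "f n \<in> f ` S" by (metis image_eqI)
  qed
  with False have inf: "infinite S"
    by (meson finite_imageI finite_subset)
  have "inj_on f S"
    by (auto simp: S_def inj_on_def) (metis linorder_neqE_nat)
  then have "inj (f \<circ> enumerate S)"
    using enumerate_in_set[OF inf] strict_mono_enumerate[OF inf]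
    by (intro comp_inj_on strict_mono_imp_inj_on) (auto intro: inj_on_subset)
  then show ?thesis
    using inject strict_mono_enumerate[OF inf] by blast
qed

section \<open>Montel's theorem for families omitting two values\<close>

lemma locally_uniform_limitI_cball:
  assumes "open S"
    and "\<And>z e. e > 0 \<Longrightarrow> cball z e \<subseteq> S \<Longrightarrow> uniform_limit (cball z e) f g sequentially"
  shows "locally_uniform_limit S f g"
  unfolding locally_uniform_limit_def
proof
  fix z assume "z \<in> S"
  with \<open>open S\<close> obtain e where e: "e > 0" "cball z e \<subseteq> S"
    by (meson open_contains_cball)
  then have "uniform_limit (ball z e) f g sequentially"
    using assms(2) uniform_limit_on_subset[OF _ ball_subset_cball] by blast
  with e show "\<exists>V. open V \<and> z \<in> V \<and> V \<subseteq> S \<and> uniform_limit V f g sequentially"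
    by (intro exI[of _ "ball z e"]) auto
qed

text \<open>Divergence is tested on reciprocals. Nonvanishing is required because
  \<open>inverse 0 = 0\<close>: at a zero of \<open>f n\<close> the reciprocal would look small
  although the value is not large.\<close>

lemma locally_uniform_limit_infinityI_cball:
  assumes "open S"
    and lim: "\<And>z e. e > 0 \<Longrightarrow> cball z e \<subseteq> S \<Longrightarrow>
      uniform_limit (cball z e) (\<lambda>n w. inverse (f n w)) (\<lambda>_. 0) sequentially"
    and nz: "\<And>n z. z \<in> S \<Longrightarrow> f n z \<noteq> 0"
  shows "locally_uniform_limit_infinity S f"
  unfolding locally_uniform_limit_infinity_def
proof
  fix z assume "z \<in> S"
  with \<open>open S\<close> obtain e where e: "e > 0" "cball z e \<subseteq> S"
    by (meson open_contains_cball)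
  have "\<forall>\<^sub>F n in sequentially. \<forall>w\<in>ball z e. B < norm (f n w)" for B :: real
  proof -
    \<comment> \<open>The bound is made positive so that the inequality between reciprocals can be
      inverted.\<close>
    define C where "C = max B 1"
    have "\<forall>\<^sub>F n in sequentially. \<forall>w\<in>cball z e. dist (inverse (f n w)) 0 < inverse C"
      using lim[OF e] by (rule uniform_limitD) (simp add: C_def)
    then show ?thesis
    proof (rule eventually_mono, safe)
      fix n w assume *: "\<forall>w\<in>cball z e. dist (inverse (f n w)) 0 < inverse C" and w: "w \<in> ball z e"
      have "f n w \<noteq> 0"
        using nz w e by (meson ball_subset_cball subsetD)
      moreover have "inverse (norm (f n w)) < inverse C"
        using * w by (auto simp: norm_inverse)
      ultimately have "C < norm (f n w)"
        by (subst (asm) inverse_less_iff_less) (auto simp: C_def)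
      then show "B < norm (f n w)" by (simp add: C_def)
    qed
  qed
  with e show "\<exists>V. open V \<and> z \<in> V \<and> V \<subseteq> S \<and>
      (\<forall>B. \<forall>\<^sub>F n in sequentially. \<forall>w\<in>V. B < norm (f n w))"
    by (intro exI[of _ "ball z e"]) auto
qed

text \<open>With 0 and 1 omitted, the bound at the single point \<open>w\<close> spreads to every
  compact subset of \<open>S\<close> (Schottky), and Montel's theorem for locally bounded families
  applies.\<close>

lemma Montel_omitting_0_1:
  assumes S: "open S" "connected S" "w \<in> S"
    and hol: "\<And>n::nat. f n holomorphic_on S"
    and f01: "\<And>n z. z \<in> S \<Longrightarrow> f n z \<noteq> 0 \<and> f n z \<noteq> 1"
    and le1: "\<And>n. norm (f n w) \<le> 1"
  obtains g r where "g holomorphic_on S" "strict_mono (r :: nat \<Rightarrow> nat)"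
    "\<And>K. compact K \<Longrightarrow> K \<subseteq> S \<Longrightarrow> uniform_limit K (f \<circ> r) g sequentially"
proof (rule Montel[of S "range f" f])
  fix K assume "compact K" "K \<subseteq> S"
  obtain B where "\<And>h z. h \<in> range f \<Longrightarrow> z \<in> K \<Longrightarrow> norm (h z) \<le> B"
    by (rule GPicard3[OF S, of "range f" "range f" K])
      (use hol f01 le1 \<open>compact K\<close> \<open>K \<subseteq> S\<close> in auto)
  then show "\<exists>B. \<forall>h\<in>range f. \<forall>z\<in>K. norm (h z) \<le> B" by blast
qed (use S hol in \<open>auto intro: that\<close>)

text \<open>Fix a base point \<open>w\<close>. Either infinitely many \<open>f n w\<close> lie in
  the closed unit disc, or the reciprocals eventually do; in both cases a sequence bounded at
  \<open>w\<close> has a convergent subsequence.\<close>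

lemma normal_family_on_omitting_0_1:
  assumes S: "open S" "connected S"
    and hol: "\<And>h. h \<in> \<F> \<Longrightarrow> h holomorphic_on S"
    and f01: "\<And>h z. h \<in> \<F> \<Longrightarrow> z \<in> S \<Longrightarrow> h z \<noteq> 0 \<and> h z \<noteq> 1"
  shows "normal_family_on \<F> S"
proof (cases "S = {}")
  case True
  then show ?thesis
    by (auto simp: normal_family_on_def locally_uniform_limit_infinity_def intro: strict_mono_id)
next
  case False
  then obtain w where w: "w \<in> S" by blast
  show ?thesis
    unfolding normal_family_on_def
  proof (intro allI impI)
    fix f :: "nat \<Rightarrow> complex \<Rightarrow> complex" assume "range f \<subseteq> \<F>"
    then have fhol: "f n holomorphic_on S" and ff01: "z \<in> S \<Longrightarrow> f n z \<noteq> 0 \<and> f n z \<noteq> 1" for n z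
      using hol f01 by (auto simp: image_subset_iff)
    show "\<exists>r :: nat \<Rightarrow> nat. strict_mono r \<and>
           ((\<exists>g. g holomorphic_on S \<and> locally_uniform_limit S (f \<circ> r) g) \<or>
            locally_uniform_limit_infinity S (f \<circ> r))"
    proof (cases "\<forall>\<^sub>F n in sequentially. norm (f n w) > 1")
      case False
      then obtain r :: "nat \<Rightarrow> nat" where r: "strict_mono r" "\<And>n. norm (f (r n) w) \<le> 1"
        by (metis not_eventually_sequentiallyD not_less)
      obtain g s where "g holomorphic_on S" and s: "strict_mono (s :: nat \<Rightarrow> nat)"
        and lim: "\<And>K. compact K \<Longrightarrow> K \<subseteq> S \<Longrightarrow> uniform_limit K ((f \<circ> r) \<circ> s) g sequentially"
        by (rule Montel_omitting_0_1[OF S w, of "f \<circ> r"]) (use fhol ff01 r in auto)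
      moreover have "locally_uniform_limit S (f \<circ> (r \<circ> s)) g"
        using lim by (intro locally_uniform_limitI_cball S) (auto simp: o_assoc)
      ultimately show ?thesis
        using strict_mono_o[OF r(1) s] by blast
    next
      case True
      then obtain N where N: "\<And>n. n \<ge> N \<Longrightarrow> norm (f n w) > 1"
        by (auto simp: eventually_sequentially)
      \<comment> \<open>Reciprocals again omit 0 and 1, and dropping the first \<open>N\<close>
        terms bounds all of them at \<open>w\<close>.\<close>
      define h where "h = (\<lambda>n z. inverse (f (n + N) z))"
      have hhol: "h n holomorphic_on S" for n
        unfolding h_def using fhol ff01 by (intro holomorphic_intros) auto
      have h01: "h n z \<noteq> 0 \<and> h n z \<noteq> 1" if "z \<in> S" for n z
        using ff01[OF that] by (auto simp: h_def)
      have "norm (h n w) \<le> 1" for n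
        using N[of "n + N"] by (simp add: h_def norm_inverse inverse_le_1_iff)
      then obtain g s where g: "g holomorphic_on S" and s: "strict_mono (s :: nat \<Rightarrow> nat)"
        and lim: "\<And>K. compact K \<Longrightarrow> K \<subseteq> S \<Longrightarrow> uniform_limit K (h \<circ> s) g sequentially"
        using Montel_omitting_0_1[OF S w, of h] hhol h01 by metis
      define r where "r = (\<lambda>n. s n + N)"
      have r: "strict_mono r"
        using s by (simp add: r_def strict_mono_def)
      show ?thesis
      \<comment> \<open>By Hurwitz the limit of zero-free reciprocals is identically zero or
        zero-free: the first gives the limit infinity, the second the holomorphic limit
        \<open>inverse \<circ> g\<close>.\<close>
      proof (cases "\<forall>z\<in>S. g z = 0")
        case True
        have "locally_uniform_limit_infinity S (f \<circ> r)"
        proof (rule locally_uniform_limit_infinityI_cball)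
          fix z e assume "cball z e \<subseteq> S"
          then have "uniform_limit (cball z e) (h \<circ> s) g sequentially"
            using lim by simp
          then show "uniform_limit (cball z e) (\<lambda>n w. inverse ((f \<circ> r) n w)) (\<lambda>_. 0) sequentially"
            by (rule uniform_limit_cong[THEN iffD1, rotated -1])
              (use True \<open>cball z e \<subseteq> S\<close> in \<open>auto simp: h_def r_def\<close>)
        qed (use S ff01 in auto)
        with r show ?thesis by blast
      next
        case False
        have gnz: "g z \<noteq> 0" if "z \<in> S" for z
        proof (cases "g constant_on S")
          case True
          with False that show ?thesis by (auto simp: constant_on_def)
        next
          case False
          show ?thesis
            by (rule Hurwitz_no_zeros[OF S, of "h \<circ> s"]) (use hhol h01 g lim False that in auto)
        qed
        have "locally_uniform_limit S (f \<circ> r) (inverse \<circ> g)"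
        proof (rule locally_uniform_limitI_cball)
          fix z e assume e: "e > (0::real)" "cball z e \<subseteq> S"
          \<comment> \<open>The positive minimum of \<open>norm (g x)\<close> on the closed disc
            keeps the passage to reciprocals uniform.\<close>
          have "continuous_on (cball z e) (\<lambda>x. norm (g x))"
            using g e by (intro continuous_intros holomorphic_on_imp_continuous_on)
              (auto intro: holomorphic_on_subset)
          then obtain x where x: "x \<in> cball z e" "\<And>y. y \<in> cball z e \<Longrightarrow> norm (g x) \<le> norm (g y)"
            using continuous_attains_inf[of "cball z e" "\<lambda>x. norm (g x)"] e by force
          have "uniform_limit (cball z e) (\<lambda>n y. inverse ((h \<circ> s) n y)) (inverse \<circ> g) sequentially"
            by (rule uniform_lim_inverse[OF lim[OF compact_cball e(2)] x(2)])
              (use e gnz x in auto)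
          then show "uniform_limit (cball z e) (f \<circ> r) (inverse \<circ> g) sequentially"
            by (simp add: h_def r_def o_def)
        qed fact
        moreover have "(inverse \<circ> g) holomorphic_on S"
          unfolding o_def using g gnz by (intro holomorphic_intros) auto
        ultimately show ?thesis using r by blast
      qed
    qed
  qed
qed

text \<open>Allows any two omitted values to be normalized to 0 and 1.\<close>

lemma normal_family_on_affine_image:
  assumes "normal_family_on ((\<lambda>h z. (h z - a) / c) ` \<F>) S" "c \<noteq> 0"
  shows "normal_family_on \<F> S"
  unfolding normal_family_on_def
proof (intro allI impI)
  fix f :: "nat \<Rightarrow> complex \<Rightarrow> complex" assume "range f \<subseteq> \<F>"
  define h where "h = (\<lambda>n z. (f n z - a) / c)"
  have f: "f n = (\<lambda>z. c * h n z + a)" for n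
    using \<open>c \<noteq> 0\<close> by (simp add: h_def)
  have "range h \<subseteq> (\<lambda>h z. (h z - a) / c) ` \<F>"
    using \<open>range f \<subseteq> \<F>\<close> by (auto simp: h_def)
  then obtain r :: "nat \<Rightarrow> nat" where r: "strict_mono r" 
    and "(\<exists>g. g holomorphic_on S \<and> locally_uniform_limit S (h \<circ> r) g) \<or>
            locally_uniform_limit_infinity S (h \<circ> r)"
    using assms(1) unfolding normal_family_on_def by metis
  then consider g where "g holomorphic_on S" "locally_uniform_limit S (h \<circ> r) g"
    | "locally_uniform_limit_infinity S (h \<circ> r)" by blast
  then show "\<exists>r :: nat \<Rightarrow> nat. strict_mono r \<and>
           ((\<exists>g. g holomorphic_on S \<and> locally_uniform_limit S (f \<circ> r) g) \<or>
            locally_uniform_limit_infinity S (f \<circ> r))"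
  proof cases
    case 1
    have "uniform_limit V (f \<circ> r) (\<lambda>z. c * g z + a) sequentially"
      if "uniform_limit V (h \<circ> r) g sequentially" for V
    proof -
      have "uniform_limit V (\<lambda>n z. c * (h \<circ> r) n z + a) (\<lambda>z. c * g z + a) sequentially"
        by (intro uniform_limit_intros that
            bounded_linear.uniform_limit[OF bounded_linear_mult_right that])
      then show ?thesis by (simp add: f o_def)
    qed
    with 1 have "locally_uniform_limit S (f \<circ> r) (\<lambda>z. c * g z + a)"
      unfolding locally_uniform_limit_def by meson
    moreover have "(\<lambda>z. c * g z + a) holomorphic_on S"
      by (intro holomorphic_intros 1)
    ultimately show ?thesis using r by blast
  next
    case 2
    have "\<forall>\<^sub>F n in sequentially. \<forall>w\<in>V. B < norm ((f \<circ> r) n w)"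
      if *: "\<forall>B. \<forall>\<^sub>F n in sequentially. \<forall>w\<in>V. B < norm ((h \<circ> r) n w)" for V B
    proof (rule eventually_mono[OF *[rule_format, of "(B + norm a) / norm c"]], safe)
      fix n w assume "\<forall>w\<in>V. (B + norm a) / norm c < norm ((h \<circ> r) n w)" "w \<in> V"
      then have "(B + norm a) / norm c < norm (h (r n) w)" by simp
      then have "B + norm a < norm (c * h (r n) w)"
        using \<open>c \<noteq> 0\<close> by (simp add: norm_mult divide_less_eq mult.commute)
      then show "B < norm ((f \<circ> r) n w)"
        using norm_diff_ineq[of "c * h (r n) w" a] by (simp add: f)
    qed
    with 2 have "locally_uniform_limit_infinity S (f \<circ> r)"
      unfolding locally_uniform_limit_infinity_def by meson
    with r show ?thesis by blast
  qed
qed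

lemma normal_family_on_omitting:
  assumes "open S" "connected S" "a \<noteq> b"
    and "\<And>h. h \<in> \<F> \<Longrightarrow> h holomorphic_on S"
    and "\<And>h z. h \<in> \<F> \<Longrightarrow> z \<in> S \<Longrightarrow> h z \<noteq> a \<and> h z \<noteq> b"
  shows "normal_family_on \<F> S"
proof (rule normal_family_on_affine_image)
  show "normal_family_on ((\<lambda>h z. (h z - a) / (b - a)) ` \<F>) S"
    by (rule normal_family_on_omitting_0_1)
      (use assms in \<open>auto intro!: holomorphic_intros\<close>)
qed (use assms in auto)

section \<open>Entire functions of finite order under composition\<close>

lemma holomorphic_on_UNIV_funpow:
  assumes "f holomorphic_on UNIV"
  shows "(f ^^ n) holomorphic_on UNIV"
proof (induction n)
  case 0
  then show ?case by (simp add: id_def)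
next
  case (Suc n)
  then show ?case
    using holomorphic_on_compose_gen[OF _ assms, of "f ^^ n" UNIV] by (simp add: o_def)
qed

text \<open>\<open>f ^^ (j - i)\<close> fixes the range of \<open>f ^^ i\<close> pointwise. That
  range is open by the open mapping theorem, so the identity theorem finishes.\<close>

lemma nonconstant_entire_funpow_eq_imp_id:
  assumes hol: "f holomorphic_on UNIV" and "i < j" and eq: "f ^^ i = f ^^ j"
    and nonconst: "\<not> f constant_on UNIV"
  shows "f ^^ (j - i) = id"
proof -
  have hol_pow: "(f ^^ n) holomorphic_on UNIV" for n
    by (rule holomorphic_on_UNIV_funpow[OF hol])
  have "open (range (f ^^ n))" for n
  proof (induction n)
    case (Suc n)
    have "open (f ` range (f ^^ n))"
      by (rule open_mapping_thm[OF hol]) (use Suc nonconst in auto)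
    then show ?case by (simp add: image_comp o_def)
  qed simp
  then have "open (range (f ^^ i))" .
  have *: "(f ^^ (j - i)) z = z" if z: "z \<in> range (f ^^ i)" for z
  proof -
    obtain w where "z = (f ^^ i) w" using z by blast
    then have "(f ^^ (j - i)) z = (f ^^ (j - i + i)) w"
      by (simp add: funpow_add)
    also have "\<dots> = z" using \<open>i < j\<close> eq \<open>z = (f ^^ i) w\<close> by simp
    finally show ?thesis .
  qed
  have "(f ^^ (j - i)) z = z" for z
    by (rule analytic_continuation_open[of "range (f ^^ i)" UNIV "f ^^ (j - i)" "\<lambda>z. z"])
      (use \<open>open (range (f ^^ i))\<close> hol_pow * in auto)
  then show ?thesis by auto
qed

text \<open>The continuous left inverse \<open>f ^^ (n - 1)\<close> makes \<open>f\<close> tend to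
  infinity at infinity, so \<open>f\<close> is a polynomial. Degrees multiply under composition,
  which forces degree 1.\<close>

lemma entire_finite_order_affine:
  assumes hol: "f holomorphic_on UNIV" and "n > 0" and id: "f ^^ n = id"
  obtains a b where "f = (\<lambda>z. a + b * z)" "norm b = 1"
proof -
  define g where "g = f ^^ (n - 1)"
  have gf: "g (f z) = z" for z
  proof -
    have "g (f z) = (f ^^ Suc (n - 1)) z"
      unfolding g_def funpow_Suc_right by simp
    also have "\<dots> = z" using \<open>n > 0\<close> id by simp
    finally show ?thesis .
  qed
  have cont_g: "continuous_on UNIV g"
    unfolding g_def
    by (intro holomorphic_on_imp_continuous_on holomorphic_on_UNIV_funpow hol)
  have "filterlim f at_infinity at_infinity"
  proof (subst filterlim_at_infinity[of 0], simp, intro allI impI)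
    fix B :: real
    have "compact (g ` cball 0 B)"
      by (intro compact_continuous_image continuous_on_subset[OF cont_g]) auto
    then obtain C where "\<forall>w\<in>g ` cball 0 B. norm w \<le> C"
      using compact_imp_bounded bounded_iff by blast
    then have C: "norm (g w) \<le> C" if "norm w \<le> B" for w
      using that by simp
    show "\<forall>\<^sub>F z in at_infinity. B \<le> norm (f z)"
      unfolding eventually_at_infinity
    proof (intro exI[of _ "C + 1"] allI impI)
      fix z :: complex assume "C + 1 \<le> norm z"
      then show "B \<le> norm (f z)" using C[of "f z"] gf[of z] by force
    qed
  qed
  then have "((inverse \<circ> f) \<longlongrightarrow> 0) at_infinity"
    unfolding o_def by (intro filterlim_compose[OF tendsto_inverse_0])
  then obtain c N where c: "\<And>z. f z = (\<Sum>i\<le>N. c i * z ^ i)"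
    using pole_at_infinity[OF hol] by blast
  define p where "p = (\<Sum>i\<le>N. monom (c i) i)"
  have fp: "f = poly p"
    by (auto simp: p_def c poly_sum poly_monom)
  have "\<exists>q. f ^^ k = poly q \<and> degree q = degree p ^ k" for k
  proof (induction k)
    case 0
    show ?case by (rule exI[of _ "[:0, 1:]"]) auto
  next
    case (Suc k)
    then obtain q where "f ^^ k = poly q" "degree q = degree p ^ k" by blast
    then show ?case
      by (intro exI[of _ "pcompose p q"]) (auto simp: fp poly_pcompose degree_pcompose)
  qed
  then obtain q where q: "f ^^ n = poly q" "degree q = degree p ^ n" by blast
  have "q = [:0, 1:]"
    using q(1) id by (intro poly_eq_poly_eq_iff[THEN iffD1]) auto
  with q(2) have "degree p ^ n = Suc 0" by simp
  with \<open>n > 0\<close> have "degree p = 1" by (simp only: nat_power_eq_Suc_0_iff) simp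
  then obtain a p' where "p = pCons a p'" "degree p' = 0"
    by (cases p) (auto split: if_splits)
  then obtain b where p: "p = [:a, b:]"
    by (auto elim: degree_eq_zeroE)
  then have f: "f = (\<lambda>z. a + b * z)"
    by (auto simp: fp mult.commute)
  \<comment> \<open>Subtracting the value at 0 cancels the translation part of the iterate and
    isolates its multiplier.\<close>
  have "(f ^^ k) 1 - (f ^^ k) 0 = b ^ k" for k
  proof (induction k)
    case (Suc k)
    have "(f ^^ Suc k) 1 - (f ^^ Suc k) 0 = b * ((f ^^ k) 1 - (f ^^ k) 0)"
      by (simp add: f algebra_simps)
    then show ?case using Suc by simp
  qed simp
  from this[of n] have "b ^ n = 1" using id by simp
  then have "norm b = 1"
    using \<open>n > 0\<close> power_eq_1_iff by blast
  with f that show ?thesis by blast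
qed

text \<open>By great Picard at infinity, the function or its reciprocal has a finite limit there, so
  it is constant or a polynomial. A nonconstant polynomial attains both 0 and 1, and would have to
  do so at the same point \<open>p\<close>.\<close>

lemma entire_omitting_0_1_off_point_constant:
  assumes hol: "h holomorphic_on UNIV" and h01: "\<And>z. z \<noteq> p \<Longrightarrow> h z \<noteq> 0 \<and> h z \<noteq> 1"
  shows "h z = h p"
proof -
  define k where "k = (\<lambda>z. h (p + z))"
  have holk: "k holomorphic_on UNIV"
    unfolding k_def
    by (rule holomorphic_on_compose_gen[OF _ hol, unfolded o_def]) (auto intro: holomorphic_intros)
  have k01: "k z \<noteq> 0 \<and> k z \<noteq> 1" if "z \<noteq> 0" for z
    using h01[of "p + z"] that by (simp add: k_def)
  \<comment> \<open>Inversion turns infinity into an isolated singularity at 0, where great Picard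
    applies.\<close>
  have "(k \<circ> inverse) holomorphic_on UNIV - {0}"
    using holk by (intro holomorphic_on_compose_gen[of inverse _ k UNIV] holomorphic_intros) auto
  then obtain l where "((k \<circ> inverse) \<longlongrightarrow> l) (at 0) \<or> ((inverse \<circ> (k \<circ> inverse)) \<longlongrightarrow> l) (at 0)"
    by (rule great_Picard[OF open_UNIV UNIV_I zero_neq_one]) (use k01 in auto)
  then have "(k \<longlongrightarrow> l) at_infinity \<or> ((inverse \<circ> k) \<longlongrightarrow> l) at_infinity"
    by (simp add: lim_at_infinity_0 o_def)
  then have "k w = k 0" for w
  proof
    assume "(k \<longlongrightarrow> l) at_infinity"
    then show ?thesis using Liouville_weak[OF holk] by metis
  next
    assume "((inverse \<circ> k) \<longlongrightarrow> l) at_infinity"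
    then obtain c N where c: "\<And>z. k z = (\<Sum>i\<le>N. c i * z ^ i)"
      using pole_at_infinity[OF holk] by blast
    show ?thesis
    proof (cases "\<exists>i\<in>{1..N}. c i \<noteq> 0")
      case False
      then have "k z = (\<Sum>i\<in>{0}. c i * z ^ i)" for z
        unfolding c by (intro sum.mono_neutral_right) (auto simp: Suc_le_eq)
      then show ?thesis by simp
    next
      case True
      \<comment> \<open>The coefficients of \<open>k z - 1\<close>, whose root is a point where
        \<open>k\<close> equals 1.\<close>
      define d where "d = c(0 := c 0 - 1)"
      have d: "(\<Sum>i\<le>N. d i * z ^ i) = k z - 1" for z
        unfolding c by (simp add: d_def sum.atMost_shift)
      obtain u where "k u = 0"
        by (rule Cauchy_Integral_Formula.fundamental_theorem_of_algebra[of c N])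
          (use True in blast, simp add: c)
      moreover obtain v where "k v = 1"
        by (rule Cauchy_Integral_Formula.fundamental_theorem_of_algebra[of d N])
          (use True in \<open>force simp: d_def\<close>, simp add: d)
      moreover have "u = 0" "v = 0"
        using k01 \<open>k u = 0\<close> \<open>k v = 1\<close> by blast+
      ultimately show ?thesis by simp
    qed
  qed
  from this[of "z - p"] show ?thesis by (simp add: k_def)
qed

section \<open>The escaping like set\<close>

lemma entire_semigroup_funpow:
  assumes "entire_semigroup \<F>" "f \<in> \<F>" "n > 0"
  shows "f ^^ n \<in> \<F>"
  using \<open>n > 0\<close>
proof (induction n rule: nat_induct_non_zero)
  case 1
  then show ?case using assms by (simp add: o_def)
next
  case (Suc n)
  then have "f \<circ> f ^^ n \<in> \<F>" using assms by (simp add: entire_semigroup_def del: funpow.simps)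
  then show ?case by (simp add: o_def)
qed

text \<open>If the iterates of \<open>f\<close> were distinct they would have to escape at the periodic point.\<close>
lemma escaping_periodic_point_cases:
  assumes sg: "entire_semigroup \<F>" and "f \<in> \<F>" and x: "x \<in> escaping_like \<F>"
    and "k > 0" and per: "(f ^^ k) x = x"
  obtains (const) "f constant_on UNIV" | (affine) a b where "f = (\<lambda>z. a + b * z)" "norm b = 1"
proof -
  have hol: "f holomorphic_on UNIV"
    using sg \<open>f \<in> \<F>\<close> by (auto simp: entire_semigroup_def)
  \<comment> \<open>\<open>Suc n\<close> keeps the exponent positive, since the identity need not
    belong to the semigroup.\<close>
  define g where "g = (\<lambda>n. f ^^ (k * Suc n))"
  have "range g \<subseteq> \<F>"
    using entire_semigroup_funpow[OF sg \<open>f \<in> \<F>\<close>] \<open>k > 0\<close> by (auto simp: g_def)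
  have "((f ^^ k) ^^ n) x = x" for n
    using per by (induction n) auto
  then have gx: "g n x = x" for n
    unfolding g_def by (metis funpow_mult)
  have "\<not> filterlim (\<lambda>n. g n x) at_infinity sequentially"
    unfolding gx by (metis not_tendsto_and_filterlim_at_infinity sequentially_bot tendsto_const)
  with x \<open>range g \<subseteq> \<F>\<close> have "\<not> inj g"
    unfolding escaping_like_def infinite_sequence_in_def by blast
  then obtain m n where "m < n" "g m = g n"
    by (metis injI linorder_neqE_nat)
  then have *: "k * Suc m < k * Suc n" "f ^^ (k * Suc m) = f ^^ (k * Suc n)"
    using \<open>k > 0\<close> by (auto simp: g_def)
  show ?thesis
  proof (cases "f constant_on UNIV")
    case True
    then show ?thesis by (rule const)
  next
    case False
    have "f ^^ (k * Suc n - k * Suc m) = id"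
      by (rule nonconstant_entire_funpow_eq_imp_id[OF hol * False])
    with *(1) show ?thesis
      using entire_finite_order_affine[OF hol] affine by (metis zero_less_diff)
  qed
qed

text \<open>Escape at a single point spreads over a set on which all members of the family are
  uniformly comparable, up to a bounded error, with their value at that point.\<close>
lemma normal_family_on_escaping_comparable:
  assumes z: "z \<in> escaping_like \<F>" and "open S"
    and hol: "\<And>f. f \<in> \<F> \<Longrightarrow> f holomorphic_on S"
    and "c > 0" and le: "\<And>f w. f \<in> \<F> \<Longrightarrow> w \<in> S \<Longrightarrow> c * norm (f z) - C \<le> norm (f w)"
  shows "normal_family_on \<F> S"
  unfolding normal_family_on_def
proof (intro allI impI)
  fix f :: "nat \<Rightarrow> complex \<Rightarrow> complex" assume f: "range f \<subseteq> \<F>"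
  show "\<exists>r :: nat \<Rightarrow> nat. strict_mono r \<and>
           ((\<exists>g. g holomorphic_on S \<and> locally_uniform_limit S (f \<circ> r) g) \<or>
            locally_uniform_limit_infinity S (f \<circ> r))"
  proof (cases rule: subsequence_injective_or_constant[of f])
    case (inject r)
    then have "filterlim (\<lambda>n. (f \<circ> r) n z) at_infinity sequentially"
      using z f unfolding escaping_like_def infinite_sequence_in_def by fastforce
    then have lim: "\<forall>\<^sub>F n in sequentially. B \<le> norm ((f \<circ> r) n z)" for B
      by (auto simp: filterlim_at_infinity_conv_norm_at_top filterlim_at_top)
    have "\<forall>\<^sub>F n in sequentially. \<forall>w\<in>S. B < norm ((f \<circ> r) n w)" for B
    \<comment> \<open>The threshold is solved from \<open>c * norm (f z) - C \<ge> B + 1\<close>;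
      the extra 1 makes the final bound strict.\<close>
    proof (rule eventually_mono[OF lim[of "(B + C + 1) / c"]], safe)
      fix n w assume "(B + C + 1) / c \<le> norm ((f \<circ> r) n z)" "w \<in> S"
      then have "B + C + 1 \<le> c * norm (f (r n) z)"
        using \<open>c > 0\<close> by (simp add: pos_divide_le_eq mult.commute)
      then show "B < norm ((f \<circ> r) n w)"
        using le[of "f (r n)" w] f \<open>w \<in> S\<close> by (simp add: image_subset_iff)
    qed
    with inject(1) \<open>open S\<close> show ?thesis
      unfolding locally_uniform_limit_infinity_def by blast
  next
    case (const r g)
    then have "locally_uniform_limit S (f \<circ> r) g"
      unfolding locally_uniform_limit_def using \<open>open S\<close>
      by (intro ballI exI[of _ S]) (auto intro!: uniform_limitI)
    moreover have "g holomorphic_on S"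
      using const(2)[of 0] f hol by auto
    ultimately show ?thesis using const(1) by blast
  qed
qed

text \<open>Away from \<open>p\<close>, the quotient \<open>(f z - p) / (z - p)\<close> never
  vanishes, and it equals 1 exactly at fixed points of \<open>f\<close>, which then escape. A fixed
  point there makes \<open>f\<close> constant or affine; without one the quotient omits 0 and 1 and
  is constant.\<close>

lemma affine_off_escaping_complement:
  assumes sg: "entire_semigroup \<F>" and I: "escaping_like \<F> = - {p}" and "f \<in> \<F>"
    and fp: "\<And>z. f z = p \<longleftrightarrow> z = p"
  obtains c where "\<And>z. f z = p + c * (z - p)"
proof -
  have hol: "f holomorphic_on UNIV"
    using sg \<open>f \<in> \<F>\<close> by (auto simp: entire_semigroup_def)
  \<comment> \<open>The value \<open>deriv f p\<close> removes the singularity at \<open>p\<close>,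
    since \<open>f p = p\<close>.\<close>
  define h where "h = (\<lambda>z. if z = p then deriv f p else (f z - f p) / (z - p))"
  have "f p = p" using fp by simp
  then have f: "f z = p + h z * (z - p)" for z
    by (simp add: h_def)
  show ?thesis
  proof (cases "\<exists>x. x \<noteq> p \<and> f x = x")
    case True
    then obtain x where "x \<in> escaping_like \<F>" "(f ^^ 1) x = x"
      by (auto simp: I)
    then consider "f constant_on UNIV" | a b where "f = (\<lambda>z. a + b * z)"
      using escaping_periodic_point_cases[OF sg \<open>f \<in> \<F>\<close> _ zero_less_one] by metis
    then show ?thesis
    proof cases
      case 1
      then have "f (p + 1) = p" using \<open>f p = p\<close> unfolding constant_on_def by force
      then show ?thesis using fp by simp
    next
      case (2 a b)
      then have "f z = p + b * (z - p)" for z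
        using \<open>f p = p\<close> by (metis add_diff_cancel_left add_diff_eq add_uminus_conv_diff diff_add_cancel right_diff_distrib)
      then show ?thesis by (rule that)
    qed
  next
    case False
    have "h holomorphic_on UNIV"
      unfolding h_def by (rule pole_lemma_open[OF hol open_UNIV])
    moreover have "h z \<noteq> 0 \<and> h z \<noteq> 1" if "z \<noteq> p" for z
      using f[of z] fp[of z] False that by force
    ultimately have "h z = h p" for z
      by (rule entire_omitting_0_1_off_point_constant)
    then show ?thesis using f that by metis
  qed
qed

section \<open>Normality in the interior of the escaping like set and its failure on the
  frontier\<close>

lemma normal_at_interior_escaping:
  assumes sg: "entire_semigroup \<F>"
    and fwd: "forward_invariant \<F> (escaping_like \<F>)"
    and bwd: "backward_invariant \<F> (escaping_like \<F>)"
    and z: "z \<in> interior (escaping_like \<F>)"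
  shows "z \<in> fatou_like \<F>"
proof -
  define I where "I = escaping_like \<F>"
  have hol: "f holomorphic_on S" if "f \<in> \<F>" for f S
    using sg that holomorphic_on_subset by (auto simp: entire_semigroup_def)
  have fI: "f w \<in> I \<longleftrightarrow> w \<in> I" if "f \<in> \<F>" for f w
    using fwd bwd that unfolding I_def forward_invariant_def backward_invariant_def by blast
  have "z \<in> I" using z interior_subset by (auto simp: I_def)
  have "\<exists>e>0. normal_family_on \<F> (ball z e)"
  proof -
    consider (two) c d where "c \<notin> I" "d \<notin> I" "c \<noteq> d" | (all) "I = UNIV" | (one) p where "I = - {p}"
      by (cases "I = UNIV") blast+
    then show ?thesis
    proof cases
      case two
      obtain e where "e > 0" "ball z e \<subseteq> I"
        using z by (auto simp: I_def mem_interior)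
      moreover have "normal_family_on \<F> (ball z e)"
        using hol fI two calculation(2) by (intro normal_family_on_omitting[of _ c d]) auto
      ultimately show ?thesis by blast
    next
      case all
      \<comment> \<open>Every member is constant or a Euclidean isometry, so its values at points
        less than 1 apart differ by at most 1.\<close>
      have *: "1 * norm (f z) - 1 \<le> norm (f w)" if "f \<in> \<F>" "w \<in> ball z 1" for f w
      proof -
        have "norm (f z - f w) \<le> 1"
        proof (cases "f constant_on UNIV")
          case True
          then show ?thesis by (auto simp: constant_on_def)
        next
          case nonconst: False
          obtain a b where f: "f = (\<lambda>z. a + b * z)" "norm b = 1"
          proof (cases "\<exists>a. f = (\<lambda>x. a + x)")
            case True
            then show ?thesis using that[of _ 1] by auto
          next
            case False
            then obtain x where "(f ^^ 2) x = x"
              using holomorphic_involution_point[OF hol[OF \<open>f \<in> \<F>\<close>]]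
              by (metis comp_apply funpow.simps(2) funpow_0 numeral_2_eq_2)
            moreover have "x \<in> escaping_like \<F>" using all by (simp add: I_def)
            ultimately show ?thesis
              using escaping_periodic_point_cases[OF sg \<open>f \<in> \<F>\<close>, of x 2] nonconst that by auto
          qed
          have "norm (f z - f w) = norm (z - w)"
            using f by (simp add: norm_mult flip: right_diff_distrib)
          then show ?thesis using \<open>w \<in> ball z 1\<close> by (simp add: dist_norm)
        qed
        then show ?thesis using norm_triangle_ineq2[of "f z" "f w"] by simp
      qed
      have "normal_family_on \<F> (ball z 1)"
        by (rule normal_family_on_escaping_comparable[OF _ _ _ zero_less_one *])
          (use \<open>z \<in> I\<close> hol in \<open>auto simp: I_def\<close>)
      then show ?thesis using zero_less_one by blast
    next
      case (one p)
      \<comment> \<open>On this disc every \<open>w\<close> keeps at least half the distance of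
        \<open>z\<close> from \<open>p\<close>.\<close>
      define e where "e = norm (z - p) / 2"
      have "e > 0" using \<open>z \<in> I\<close> one by (simp add: e_def)
      \<comment> \<open>As \<open>f\<close> is linear about \<open>p\<close>, the displacement of
        \<open>f w\<close> from \<open>p\<close> is at least half that of \<open>f z\<close>.
        Passing from displacements to norms costs \<open>norm p / 2\<close> for \<open>f z\<close>
        and \<open>norm p\<close> for \<open>f w\<close>.\<close>
      have *: "(1/2) * norm (f z) - (3/2) * norm p \<le> norm (f w)" if "f \<in> \<F>" "w \<in> ball z e" for f w
      proof -
        obtain c where c: "\<And>z. f z = p + c * (z - p)"
          using affine_off_escaping_complement[OF sg _ \<open>f \<in> \<F>\<close>, of p] one fI[OF \<open>f \<in> \<F>\<close>]
          by (metis Compl_iff I_def singleton_iff)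
        have "norm (z - p) \<le> norm (z - w) + norm (w - p)"
          using norm_triangle_ineq[of "z - w" "w - p"] by simp
        with that have "e \<le> norm (w - p)"
          by (simp add: dist_norm e_def)
        then have "norm (c * (z - p)) / 2 \<le> norm (c * (w - p))"
          unfolding norm_mult e_def by (metis mult_left_mono norm_ge_zero times_divide_eq_right)
        moreover have "norm (f z) \<le> norm p + norm (c * (z - p))"
          unfolding c by (rule norm_triangle_ineq)
        moreover have "norm (c * (w - p)) - norm p \<le> norm (f w)"
          unfolding c by (metis add.commute norm_diff_ineq)
        ultimately show ?thesis by (simp add: field_simps)
      qed
      have "normal_family_on \<F> (ball z e)"
        by (rule normal_family_on_escaping_comparable[OF _ _ _ _ *])
          (use \<open>z \<in> I\<close> hol in \<open>auto simp: I_def\<close>)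
      with \<open>e > 0\<close> show ?thesis by blast
    qed
  qed
  then show ?thesis
    unfolding fatou_like_def by (metis (mono_tags) centre_in_ball mem_Collect_eq open_ball)
qed

lemma not_normal_at_frontier_escaping:
  assumes z: "z \<in> frontier (escaping_like \<F>)"
  shows "z \<notin> fatou_like \<F>"
proof
  assume "z \<in> fatou_like \<F>"
  then obtain U where U: "open U" "z \<in> U" and normal: "normal_family_on \<F> U"
    by (auto simp: fatou_like_def)
  have "U \<inter> escaping_like \<F> \<noteq> {}"
    using z U by (auto simp: frontier_def closure_iff_nhds_not_empty)
  then obtain w where w: "w \<in> U" "w \<in> escaping_like \<F>" by blast
  have "\<not> U \<subseteq> escaping_like \<F>"
    using z U by (auto simp: frontier_def interior_def)
  then obtain q where q: "q \<in> U" "q \<notin> escaping_like \<F>" by blast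
  from q(2) obtain f where f: "inj f" "range f \<subseteq> \<F>"
    and "\<not> filterlim (\<lambda>n. f n q) at_infinity sequentially"
    by (auto simp: escaping_like_def infinite_sequence_in_def)
  then obtain B where "\<not> (\<forall>\<^sub>F n in sequentially. B \<le> norm (f n q))"
    by (auto simp: filterlim_at_infinity[OF order_refl])
  then obtain r :: "nat \<Rightarrow> nat" where r: "strict_mono r" "\<And>n. norm (f (r n) q) < B"
    by (metis not_eventually_sequentiallyD not_le)
  have "range (f \<circ> r) \<subseteq> \<F>" using f by auto
  then obtain s :: "nat \<Rightarrow> nat" where s: "strict_mono s"
    and lim: "(\<exists>g. g holomorphic_on U \<and> locally_uniform_limit U ((f \<circ> r) \<circ> s) g) \<or>
            locally_uniform_limit_infinity U ((f \<circ> r) \<circ> s)"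
    using normal unfolding normal_family_on_def by meson
  \<comment> \<open>The bound \<open>B\<close> at \<open>q\<close> holds along all of
    \<open>r\<close>, hence along every further subsequence.\<close>
  have "\<not> locally_uniform_limit_infinity U ((f \<circ> r) \<circ> s)"
  proof
    assume "locally_uniform_limit_infinity U ((f \<circ> r) \<circ> s)"
    then obtain V where "q \<in> V"
      and "\<forall>\<^sub>F n in sequentially. \<forall>w\<in>V. B < norm (((f \<circ> r) \<circ> s) n w)"
      using q(1) unfolding locally_uniform_limit_infinity_def by meson
    then obtain n where "B < norm (f (r (s n)) q)"
      by (auto simp: eventually_sequentially)
    with r(2)[of "s n"] show False by simp
  qed
  with lim obtain g where "locally_uniform_limit U ((f \<circ> r) \<circ> s) g" by blast
  then obtain V where "w \<in> V" "uniform_limit V ((f \<circ> r) \<circ> s) g sequentially"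
    using w(1) unfolding locally_uniform_limit_def by meson
  then have "(\<lambda>n. ((f \<circ> r) \<circ> s) n w) \<longlonglongrightarrow> g w"
    by (intro tendsto_uniform_limitI)
  \<comment> \<open>Injectivity passes to the subsequence, so it still has to escape at
    \<open>w\<close>, against its finite limit there.\<close>
  moreover have "inj ((f \<circ> r) \<circ> s)"
    by (intro inj_compose f(1) strict_mono_imp_inj_on r(1) s)
  then have "filterlim (\<lambda>n. ((f \<circ> r) \<circ> s) n w) at_infinity sequentially"
    using w(2) f(2) unfolding escaping_like_def infinite_sequence_in_def by fastforce
  ultimately show False
    using not_tendsto_and_filterlim_at_infinity[OF sequentially_bot] by blast
qed

theorem theorem3p9:
  fixes \<F> :: "(complex \<Rightarrow> complex) set"
  assumes "entire_semigroup \<F>"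
    and "\<exists>a\<in>escaping_like \<F>. \<exists>b\<in>escaping_like \<F>. a \<noteq> b"
    and "forward_invariant \<F> (escaping_like \<F>)"
    and "backward_invariant \<F> (escaping_like \<F>)"
  shows "julia_like \<F> = frontier (escaping_like \<F>)"
proof -
  obtain a b where ab: "a \<in> escaping_like \<F>" "b \<in> escaping_like \<F>" "a \<noteq> b"
    using assms(2) by blast
  have "z \<in> fatou_like \<F>" if "z \<notin> closure (escaping_like \<F>)" for z
  proof -
    have "open (- closure (escaping_like \<F>))" by auto
    then obtain e where e: "e > 0" "ball z e \<subseteq> - closure (escaping_like \<F>)"
      using \<open>z \<notin> closure (escaping_like \<F>)\<close> by (metis ComplI openE)
    then have ball: "w \<notin> escaping_like \<F>" if "w \<in> ball z e" for w
      using that closure_subset by blast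
    have "normal_family_on \<F> (ball z e)"
    proof (rule normal_family_on_omitting[of _ a b])
      \<comment> \<open>If \<open>h w\<close> were \<open>a\<close> or \<open>b\<close>, backward
        invariance would put \<open>w\<close> in the escaping like set.\<close>
      show "h w \<noteq> a \<and> h w \<noteq> b" if "h \<in> \<F>" "w \<in> ball z e" for h w
        using ball[OF that(2)] assms(4) ab that(1) by (auto simp: backward_invariant_def)
    qed (use assms(1) ab holomorphic_on_subset in \<open>auto simp: entire_semigroup_def\<close>)
    with e(1) show ?thesis
      unfolding fatou_like_def by (metis (mono_tags) centre_in_ball mem_Collect_eq open_ball)
  qed
  \<comment> \<open>The plane splits into the exterior, interior and frontier of the escaping like
    set: the first two are Fatou, the last Julia.\<close>
  then show ?thesis
    using normal_at_interior_escaping[OF assms(1,3,4)] not_normal_at_frontier_escaping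
    by (auto simp: julia_like_def frontier_def)
qed

end
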